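(* Let $n \geq 5$ be an odd integer, let $D_{2n} = \langle a, b : a^n = b^2 = 1,\ bab^{-1} = a^{-1} \rangle$, let $H$ be a subgroup of $D_{2n}$, and let $g \in K(H, D_{2n})$. (a) If $H = \langle a \rangle$, then $\Delta_{H,D_{2n}}^g$ is connected and $\operatorname{diam}(\Delta_{H,D_{2n}}^g) = 2$. (b) If $H = \langle a^r b \rangle$, where $1 \leq r \leq n$, then $\Delta_{H,D_{2n}}^g$ is connected with $\operatorname{diam}(\Delta_{H,D_{2n}}^g) = 2$ if $g = 1$, and $\Delta_{H,D_{2n}}^g$ is not connected if $g \neq 1$.
   Context: For a subgroup $H$ of a finite non-abelian group $G$, write $[x,y] = x^{-1}y^{-1}xy$, $Z(H,G) = \{x \in H : xy = yx \text{ for all } y \in G\}$ and $K(H,G) = \{[x,y] : x \in H,\ y \in G\}$. For $g \in G$, $\Delta_{H,G}^g$ is the simple graph with vertex set $G \setminus Z(H,G)$ in which two distinct vertices $x,y$ are adjacent if and only if ($x \in H$ or $y \in H$) and $[x,y] \neq g$ and $[x,y] \neq g^{-1}$. $\operatorname{diam}$ denotes the diameter of a graph. *)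

theory Defs
  imports "HOL-Algebra.Generated_Groups" "Graph_Theory.Digraph_Component" "Graph_Theory.Shortest_Path"
    "Graph_Theory.Pair_Digraph"
begin

text \<open>
  Group presentations. A word is a list of letters; \<open>(x, True)\<close> stands for the generator \<open>x\<close>
  and \<open>(x, False)\<close> for its formal inverse. A relation \<open>l = r\<close> is the pair \<open>(l, r)\<close>.
\<close>

type_synonym 'x word = "('x \<times> bool) list"

text \<open>The congruence on words generated by free cancellation and the relations in \<open>R\<close>; its classes
  form the quotient of the free group by the normal closure of \<open>R\<close>.\<close>

inductive word_eq :: "('x word \<times> 'x word) set \<Rightarrow> 'x word \<Rightarrow> 'x word \<Rightarrow> bool"
  for R :: "('x word \<times> 'x word) set" where
  refl: "word_eq R u u"
| sym: "word_eq R u v \<Longrightarrow> word_eq R v u"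
| trans: "word_eq R u v \<Longrightarrow> word_eq R v w \<Longrightarrow> word_eq R u w"
| cancel: "word_eq R (u @ [(x, e), (x, \<not> e)] @ v) (u @ v)"
| rel: "(l, r) \<in> R \<Longrightarrow> word_eq R (u @ l @ v) (u @ r @ v)"

definition eval_word :: "('g, 'm) monoid_scheme \<Rightarrow> ('x \<Rightarrow> 'g) \<Rightarrow> 'x word \<Rightarrow> 'g" where
  "eval_word G f w =
     foldr (\<lambda>(x, e) t. (if e then f x else inv\<^bsub>G\<^esub> (f x)) \<otimes>\<^bsub>G\<^esub> t) w \<one>\<^bsub>G\<^esub>"

text \<open>\<open>G = \<langle>f x (x :: 'x) : R\<rangle>\<close>: the canonical map from the group of words modulo \<open>R\<close> to \<open>G\<close> is
  well defined and bijective.\<close>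

definition presented_by ::
    "('g, 'm) monoid_scheme \<Rightarrow> ('x \<Rightarrow> 'g) \<Rightarrow> ('x word \<times> 'x word) set \<Rightarrow> bool" where
  "presented_by G f R \<longleftrightarrow> group G \<and> range f \<subseteq> carrier G \<and> generate G (range f) = carrier G \<and>
     (\<forall>u v. eval_word G f u = eval_word G f v \<longleftrightarrow> word_eq R u v)"

datatype dihedral_gen = GenA | GenB

text \<open>\<open>a\<^sup>n = 1\<close>, \<open>b\<^sup>2 = 1\<close>, \<open>b a b\<^sup>-\<^sup>1 = a\<^sup>-\<^sup>1\<close>\<close>

definition dihedral_rels :: "nat \<Rightarrow> (dihedral_gen word \<times> dihedral_gen word) set" where
  "dihedral_rels n =
     {(replicate n (GenA, True), []),
      (replicate 2 (GenB, True), []),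
      ([(GenB, True), (GenA, True), (GenB, False)], [(GenA, False)])}"

text \<open>\<open>G\<close> is the dihedral group \<open>D\<^sub>2\<^sub>n\<close> with standard generators \<open>a\<close> and \<open>b\<close>.\<close>

definition is_dihedral :: "('g, 'm) monoid_scheme \<Rightarrow> nat \<Rightarrow> 'g \<Rightarrow> 'g \<Rightarrow> bool" where
  "is_dihedral G n a b \<longleftrightarrow> presented_by G (case_dihedral_gen a b) (dihedral_rels n)"

definition commutator :: "('g, 'm) monoid_scheme \<Rightarrow> 'g \<Rightarrow> 'g \<Rightarrow> 'g" where
  "commutator G x y = inv\<^bsub>G\<^esub> x \<otimes>\<^bsub>G\<^esub> inv\<^bsub>G\<^esub> y \<otimes>\<^bsub>G\<^esub> x \<otimes>\<^bsub>G\<^esub> y"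

definition rel_center :: "'g set \<Rightarrow> ('g, 'm) monoid_scheme \<Rightarrow> 'g set" where
  "rel_center H G = {x \<in> H. \<forall>y \<in> carrier G. x \<otimes>\<^bsub>G\<^esub> y = y \<otimes>\<^bsub>G\<^esub> x}"

definition rel_commutators :: "'g set \<Rightarrow> ('g, 'm) monoid_scheme \<Rightarrow> 'g set" where
  "rel_commutators H G = {commutator G x y | x y. x \<in> H \<and> y \<in> carrier G}"

text \<open>The graph \<open>\<Delta>\<close> of \<open>H\<close>, \<open>G\<close>, \<open>g\<close>. Simple graphs are irreflexive symmetric digraphs, as in
  \<open>Graph_Theory\<close>; the relation below is symmetric since \<open>[y, x] = [x, y]\<^sup>-\<^sup>1\<close>.\<close>

definition noncomm_graph :: "'g set \<Rightarrow> ('g, 'm) monoid_scheme \<Rightarrow> 'g \<Rightarrow> 'g pair_pre_digraph" where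
  "noncomm_graph H G g =
     \<lparr>pverts = carrier G - rel_center H G,
      parcs = {(x, y). x \<in> carrier G - rel_center H G \<and> y \<in> carrier G - rel_center H G \<and> x \<noteq> y \<and>
        (x \<in> H \<or> y \<in> H) \<and> commutator G x y \<noteq> g \<and> commutator G x y \<noteq> inv\<^bsub>G\<^esub> g}\<rparr>"

text \<open>The distance is the infimum of the lengths of walks, \<open>\<infinity>\<close> if there is none.\<close>

definition graph_diameter :: "('a, 'b) pre_digraph \<Rightarrow> ereal" where
  "graph_diameter \<Gamma> = (SUP u \<in> verts \<Gamma>. SUP v \<in> verts \<Gamma>. wf_digraph.\<mu> \<Gamma> (\<lambda>_. 1) u v)"

end

theory Submission
  imports Defs "HOL-Algebra.Multiplicative_Group" "HOL-Number_Theory.Cong"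
begin

text \<open>
  The proof uses only a few features of the dihedral group. Put \<open>R = \<langle>a\<rangle>\<close>. Then \<open>R\<close> is abelian
  of index 2, it contains no involution because \<open>n\<close> is odd, and every element outside \<open>R\<close>
  (a reflection) is an involution. It follows that a reflection inverts every rotation by
  conjugation, so \<open>[x, y] = x\<^sup>-\<^sup>2\<close> for a rotation \<open>x\<close> and a reflection \<open>y\<close>, that squaring is
  injective on \<open>R\<close>, and that the centralizer of a reflection \<open>s\<close> is \<open>{1, s}\<close>. In particular the
  vertices of the graph are the nontrivial elements of the group.

  If \<open>H = R\<close>, two reflections are never adjacent, so the diameter is at least 2. For \<open>g = 1\<close> the
  graph is complete bipartite between rotations and reflections. For \<open>g = x\<^sub>0\<^sup>-\<^sup>2 \<noteq> 1\<close> any two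
  nontrivial rotations are adjacent, and every rotation outside \<open>{1, x\<^sub>0, x\<^sub>0\<^sup>-\<^sup>1}\<close> is adjacent to
  all reflections; as \<open>n \<ge> 5\<close> there is such a rotation, and it joins any two vertices that are not
  adjacent and not both rotations.

  If \<open>H = {1, s}\<close> for a reflection \<open>s\<close>, every edge contains \<open>s\<close>. For \<open>g = 1\<close> the centralizer of
  \<open>s\<close> makes the graph a star with centre \<open>s\<close>, which has at least two leaves. For \<open>g = [s, y] \<noteq> 1\<close> the only possible neighbour
  of \<open>y\<close> is \<open>s\<close>, and the edge between them is the one that \<open>g\<close> removes, so \<open>y\<close> is isolated.

  That the group given by the presentation is not smaller than expected comes from letting words
  act on the integers modulo \<open>n\<close> by \<open>x \<mapsto> x + 1\<close> and \<open>x \<mapsto> -x\<close>; every word that is trivial in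
  the presentation acts trivially.
\<close>

section \<open>Connectedness and diameter\<close>

lemma pair_wf_digraphI:
  assumes "parcs \<Gamma> \<subseteq> pverts \<Gamma> \<times> pverts \<Gamma>"
  shows "pair_wf_digraph \<Gamma>"
  using assms by unfold_locales auto

lemma connected_diameter_2:
  assumes wf: "parcs \<Gamma> \<subseteq> pverts \<Gamma> \<times> pverts \<Gamma>"
    and join: "\<And>u v. u \<in> pverts \<Gamma> \<Longrightarrow> v \<in> pverts \<Gamma> \<Longrightarrow> u \<noteq> v \<Longrightarrow> (u, v) \<notin> parcs \<Gamma> \<Longrightarrow>
                 \<exists>w. (u, w) \<in> parcs \<Gamma> \<and> (w, v) \<in> parcs \<Gamma>"
    and far: "p \<in> pverts \<Gamma>" "q \<in> pverts \<Gamma>" "p \<noteq> q" "(p, q) \<notin> parcs \<Gamma>"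
  shows "Digraph_Component.connected (with_proj \<Gamma>) \<and> graph_diameter (with_proj \<Gamma>) = 2"
proof -
  interpret pair_wf_digraph \<Gamma> by (rule pair_wf_digraphI[OF wf])
  have cost: "awalk_cost (\<lambda>_. 1) es = real (length es)" for es
    by (induct es) auto
  have walk: "\<exists>es. awalk u es v \<and> length es \<le> 2" if uv: "u \<in> pverts \<Gamma>" "v \<in> pverts \<Gamma>" for u v
  proof -
    consider "u = v" | "(u, v) \<in> parcs \<Gamma>"
      | w where "(u, w) \<in> parcs \<Gamma>" "(w, v) \<in> parcs \<Gamma>"
      using join[OF uv] by blast
    then show ?thesis
    proof cases
      case 1
      then show ?thesis using uv in_arcsD1 in_arcsD2 by (intro exI[of _ "[]"]) (simp add: awalk_def)
    next
      case 2
      then show ?thesis using uv in_arcsD1 in_arcsD2 by (intro exI[of _ "[(u, v)]"]) (simp add: awalk_def)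
    next
      case (3 w)
      then show ?thesis using uv in_arcsD1 in_arcsD2 by (intro exI[of _ "[(u, w), (w, v)]"]) (simp add: awalk_def)
    qed
  qed
  have "u \<rightarrow>\<^sup>*\<^bsub>mk_symmetric (with_proj \<Gamma>)\<^esub> v" if "u \<in> pverts \<Gamma>" "v \<in> pverts \<Gamma>" for u v
    using walk[OF that] by (intro reachable_mk_symmetricI) (auto simp: reachable_awalk)
  then have conn: "Digraph_Component.connected (with_proj \<Gamma>)"
    using far(1) unfolding Digraph_Component.connected_def strongly_connected_def by auto
  have upper: "\<mu> (\<lambda>_. 1) u v \<le> 2" if uv: "u \<in> pverts \<Gamma>" "v \<in> pverts \<Gamma>" for u v
  proof -
    obtain es where es: "awalk u es v" "length es \<le> 2" using walk[OF uv] by blast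
    have "\<mu> (\<lambda>_. 1) u v \<le> ereal (real (length es))"
      using min_cost_le_walk_cost[OF es(1), of "\<lambda>_. 1"] by (simp add: cost)
    also have "\<dots> \<le> 2" using es(2) by simp
    finally show ?thesis .
  qed
  have lower: "2 \<le> \<mu> (\<lambda>_. 1) p q"
    unfolding \<mu>_def
  proof (rule INF_greatest)
    fix es assume "es \<in> {es. awalk p es q}"
    then have es: "awalk p es q" by simp
    have "2 \<le> length es"
    proof (rule ccontr)
      assume "\<not> 2 \<le> length es"
      then have "length es = 0 \<or> length es = 1" by linarith
      then consider "es = []" | e where "es = [e]" by (auto simp: length_Suc_conv)
      then show False
        using es far by cases (auto simp: awalk_def)
    qed
    then show "2 \<le> ereal (awalk_cost (\<lambda>_. 1) es)"
      by (simp add: cost)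
  qed
  have "graph_diameter (with_proj \<Gamma>) = 2"
    unfolding graph_diameter_def
  proof (rule antisym)
    show "(SUP u\<in>verts (with_proj \<Gamma>). SUP v\<in>verts (with_proj \<Gamma>). \<mu> (\<lambda>_. 1) u v) \<le> 2"
      using upper by (intro SUP_least) simp
    have "2 \<le> (SUP v\<in>pverts \<Gamma>. \<mu> (\<lambda>_. 1) p v)"
      using far(2) lower by (rule SUP_upper2)
    then show "2 \<le> (SUP u\<in>verts (with_proj \<Gamma>). SUP v\<in>verts (with_proj \<Gamma>). \<mu> (\<lambda>_. 1) u v)"
      using far(1) by (auto intro: SUP_upper2)
  qed
  with conn show ?thesis by blast
qed

lemma not_connected_if_isolated:
  assumes wf: "parcs \<Gamma> \<subseteq> pverts \<Gamma> \<times> pverts \<Gamma>"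
    and v: "u \<in> pverts \<Gamma>" "v \<in> pverts \<Gamma>" "u \<noteq> v"
    and isolated: "\<And>w. (v, w) \<notin> parcs \<Gamma> \<and> (w, v) \<notin> parcs \<Gamma>"
  shows "\<not> Digraph_Component.connected (with_proj \<Gamma>)"
proof
  assume "Digraph_Component.connected (with_proj \<Gamma>)"
  then have "v \<rightarrow>\<^sup>*\<^bsub>mk_symmetric (with_proj \<Gamma>)\<^esub> u"
    using v unfolding Digraph_Component.connected_def strongly_connected_def by auto
  then have "(v, u) \<in> (parcs (mk_symmetric (with_proj \<Gamma>)))\<^sup>*"
    by (metis reachable_rtranclI with_proj_simps(3))
  then obtain w where "(v, w) \<in> parcs (mk_symmetric (with_proj \<Gamma>))"
    by (cases rule: converse_rtranclE) (use v(3) in auto)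
  then show False
    using isolated by (auto simp: parcs_mk_symmetric)
qed

section \<open>Groups with an abelian subgroup inverted by involutions\<close>

text \<open>The elements of \<open>R\<close> play the part of the rotations, those outside \<open>R\<close> the part of the
  reflections. Stating the commutation rules through \<open>R\<close> instead of powers of a generator keeps
  exponents modulo \<open>n\<close> out of the study of the graphs. The bound 5 guarantees a rotation different
  from \<open>1\<close>, \<open>x\<close> and \<open>x\<^sup>-\<^sup>1\<close> for any given \<open>x\<close>.\<close>

locale odd_dihedral = group G for G (structure) +
  fixes R
  assumes R_subgroup: "subgroup R G"
    and R_comm: "\<lbrakk>x \<in> R; y \<in> R\<rbrakk> \<Longrightarrow> x \<otimes> y = y \<otimes> x"
    and R_odd: "\<lbrakk>x \<in> R; x \<otimes> x = \<one>\<rbrakk> \<Longrightarrow> x = \<one>"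
    and reflection_square: "\<lbrakk>y \<in> carrier G; y \<notin> R\<rbrakk> \<Longrightarrow> y \<otimes> y = \<one>"
    and reflection_mult: "\<lbrakk>y \<in> carrier G; y \<notin> R; z \<in> carrier G; z \<notin> R\<rbrakk> \<Longrightarrow> y \<otimes> z \<in> R"
    and R_card: "5 \<le> card R"
    and R_proper: "\<exists>y \<in> carrier G. y \<notin> R"
begin

lemma R_carrier [simp]: "x \<in> R \<Longrightarrow> x \<in> carrier G"
  using R_subgroup subgroup.mem_carrier by fast

lemma R_mult: "\<lbrakk>x \<in> R; y \<in> R\<rbrakk> \<Longrightarrow> x \<otimes> y \<in> R"
  and R_inv: "x \<in> R \<Longrightarrow> inv x \<in> R"
  and R_one: "\<one> \<in> R"
  using R_subgroup by (auto intro: subgroup.m_closed subgroup.m_inv_closed subgroup.one_closed)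

lemma R_avoid:
  assumes "finite S" "card S \<le> 4"
  shows "\<exists>x \<in> R. x \<notin> S"
proof (rule ccontr)
  assume "\<not> ?thesis"
  then have "R \<subseteq> S" by blast
  then show False using card_mono[OF assms(1), of R] assms(2) R_card by simp
qed

lemma reflection_inv:
  assumes "y \<in> carrier G" "y \<notin> R"
  shows "inv y = y"
  using assms reflection_square inv_equality by blast

lemma rotation_mult_reflection:
  assumes "x \<in> R" "y \<in> carrier G" "y \<notin> R"
  shows "x \<otimes> y \<in> carrier G" "x \<otimes> y \<notin> R"
proof -
  show "x \<otimes> y \<in> carrier G" using assms by simp
  have "y = inv x \<otimes> (x \<otimes> y)" using assms by (simp add: inv_solve_left)
  then show "x \<otimes> y \<notin> R" using assms R_mult R_inv by metis
qed

text \<open>The product \<open>x y\<close> is again a reflection, and \<open>x y x y = 1\<close> says that \<open>y\<close> inverts \<open>x\<close>.\<close>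

lemma reflection_conj:
  assumes x: "x \<in> R" and y: "y \<in> carrier G" "y \<notin> R"
  shows "y \<otimes> x \<otimes> y = inv x"
proof -
  have "(x \<otimes> y) \<otimes> (x \<otimes> y) = \<one>"
    using rotation_mult_reflection[OF x y] by (rule reflection_square)
  then have "(y \<otimes> x \<otimes> y) \<otimes> x = \<one>"
    using x y by (metis R_carrier inv_comm m_assoc m_closed)
  then show ?thesis using x y by (simp add: inv_equality)
qed

lemma commutator_eq_one_iff:
  assumes "x \<in> carrier G" "y \<in> carrier G"
  shows "commutator G x y = \<one> \<longleftrightarrow> x \<otimes> y = y \<otimes> x"
proof -
  have "commutator G x y = inv (y \<otimes> x) \<otimes> (x \<otimes> y)"
    using assms by (simp add: commutator_def inv_mult_group m_assoc)
  also have "\<dots> = \<one> \<longleftrightarrow> x \<otimes> y = y \<otimes> x"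
    using assms by (metis inv_closed inv_equality inv_inv l_inv m_closed)
  finally show ?thesis .
qed

lemma commutator_inv:
  assumes "x \<in> carrier G" "y \<in> carrier G"
  shows "inv (commutator G x y) = commutator G y x"
  using assms by (simp add: commutator_def inv_mult_group m_assoc)

lemma commutator_rotation_reflection:
  assumes x: "x \<in> R" and y: "y \<in> carrier G" "y \<notin> R"
  shows "commutator G x y = inv (x \<otimes> x)"
proof -
  have "commutator G x y = inv x \<otimes> (y \<otimes> x \<otimes> y)"
    using x y by (simp add: commutator_def reflection_inv m_assoc)
  then show ?thesis using x y by (simp add: reflection_conj inv_mult_group)
qed

lemma commutator_rotations:
  assumes "x \<in> R" "y \<in> R"
  shows "commutator G x y = \<one>"
  using assms by (simp add: commutator_eq_one_iff R_comm)

text \<open>A rotation that commutes with \<open>s\<close> equals its own inverse, so it is trivial. If a reflection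
  \<open>y\<close> commutes with \<open>s\<close>, then the rotation \<open>s y\<close> commutes with \<open>s\<close> as well,
  hence \<open>s y = 1\<close>.\<close>

lemma reflection_centralizer:
  assumes s: "s \<in> carrier G" "s \<notin> R" and y: "y \<in> carrier G" and comm: "s \<otimes> y = y \<otimes> s"
  shows "y \<in> {\<one>, s}"
proof -
  have rot: "x = \<one>" if x: "x \<in> R" and "s \<otimes> x = x \<otimes> s" for x
  proof -
    have "inv x = s \<otimes> x \<otimes> s" using reflection_conj[OF x s] by simp
    also have "\<dots> = x" using that s reflection_square[OF s] by (simp add: m_assoc)
    finally have "x \<otimes> x = \<one>" using x by (metis R_carrier r_inv)
    then show ?thesis using x R_odd by blast
  qed
  show ?thesis
  proof (cases "y \<in> R")
    case True
    then show ?thesis using rot comm by blast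
  next
    case False
    have "s \<otimes> y = \<one>"
    proof (rule rot)
      show "s \<otimes> y \<in> R" using s y False by (intro reflection_mult)
      show "s \<otimes> (s \<otimes> y) = (s \<otimes> y) \<otimes> s" using s y comm by (metis m_assoc m_closed)
    qed
    then have "y = s" using s y reflection_inv by (metis inv_comm inv_equality)
    then show ?thesis by simp
  qed
qed

lemma rotation_square_inj:
  assumes "x \<in> R" "y \<in> R" "x \<otimes> x = y \<otimes> y"
  shows "x = y"
proof -
  have "(x \<otimes> inv y) \<otimes> (x \<otimes> inv y) = (x \<otimes> x) \<otimes> inv (y \<otimes> y)"
  proof -
    have "inv y \<otimes> x = x \<otimes> inv y" using assms(1,2) R_comm R_inv by blast
    then have "inv y \<otimes> (x \<otimes> inv y) = x \<otimes> (inv y \<otimes> inv y)"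
      using assms(1,2) by (simp flip: m_assoc)
    then show ?thesis using assms(1,2) by (simp add: inv_mult_group m_assoc)
  qed
  also have "\<dots> = \<one>" using assms by simp
  finally have "x \<otimes> inv y = \<one>" using assms R_odd R_mult R_inv by blast
  then show ?thesis using assms by (metis R_carrier inv_closed inv_equality inv_inv)
qed

text \<open>A central element commutes with a reflection \<open>s\<close>, so it is \<open>1\<close> or \<open>s\<close>; and \<open>s\<close> is not
  central because it commutes with no nontrivial rotation.\<close>

lemma rel_center_trivial:
  assumes "subgroup H G"
  shows "rel_center H G = {\<one>}"
proof
  show "{\<one>} \<subseteq> rel_center H G"
    using assms by (auto simp: rel_center_def subgroup.one_closed)
  show "rel_center H G \<subseteq> {\<one>}"
  proof
    fix z assume "z \<in> rel_center H G"
    then have z: "z \<in> carrier G" and central: "\<And>y. y \<in> carrier G \<Longrightarrow> z \<otimes> y = y \<otimes> z"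
      using assms by (auto simp: rel_center_def subgroup.mem_carrier)
    obtain s where s: "s \<in> carrier G" "s \<notin> R" using R_proper by blast
    obtain x where x: "x \<in> R" "x \<notin> {\<one>}" using R_avoid[of "{\<one>}"] by auto
    have "z \<in> {\<one>, s}"
      using s z central[OF s(1)] by (intro reflection_centralizer) auto
    moreover have "z \<noteq> s"
    proof
      assume "z = s"
      then have "x \<in> {\<one>, s}"
        using s x central by (intro reflection_centralizer) auto
      then show False using x s by auto
    qed
    ultimately show "z \<in> {\<one>}" by simp
  qed
qed

lemma noncomm_graph_simps:
  assumes "subgroup H G"
  shows "pverts (noncomm_graph H G g) = carrier G - {\<one>}"
    and "(x, y) \<in> parcs (noncomm_graph H G g) \<longleftrightarrow>
      x \<in> carrier G \<and> x \<noteq> \<one> \<and> y \<in> carrier G \<and> y \<noteq> \<one> \<and> x \<noteq> y \<and> (x \<in> H \<or> y \<in> H) \<and>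
      commutator G x y \<noteq> g \<and> commutator G x y \<noteq> inv g"
  using rel_center_trivial[OF assms] by (auto simp: noncomm_graph_def)

lemma noncomm_graph_wf:
  "parcs (noncomm_graph H G g) \<subseteq> pverts (noncomm_graph H G g) \<times> pverts (noncomm_graph H G g)"
  by (auto simp: noncomm_graph_def)

lemma noncomm_graph_sym:
  assumes "g \<in> carrier G" "(x, y) \<in> parcs (noncomm_graph H G g)"
  shows "(y, x) \<in> parcs (noncomm_graph H G g)"
proof -
  have xy: "x \<in> carrier G" "y \<in> carrier G"
    using assms(2) by (auto simp: noncomm_graph_def)
  have "commutator G y x = inv (commutator G x y)" "commutator G x y \<in> carrier G"
    using xy commutator_inv by (simp_all add: commutator_def inv_mult_group m_assoc)
  then have "commutator G y x = g \<longleftrightarrow> commutator G x y = inv g"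
    "commutator G y x = inv g \<longleftrightarrow> commutator G x y = g"
    using assms(1) by (metis inv_inv)+
  then show ?thesis using assms(2) by (auto simp: noncomm_graph_def)
qed

section \<open>The subgroup of rotations\<close>

text \<open>The rotation \<open>w\<close> found here is the common neighbour used for all pairs that are not adjacent
  and involve a reflection.\<close>

lemma rotation_adjacent_to_reflections:
  assumes g: "g \<in> rel_commutators R G"
  shows "\<exists>w \<in> R. w \<noteq> \<one> \<and>
    (\<forall>y \<in> carrier G. y \<notin> R \<longrightarrow> (w, y) \<in> parcs (noncomm_graph R G g))"
proof -
  \<comment> \<open>A commutator of two rotations is \<open>1 = 1\<^sup>-\<^sup>2\<close>, so every \<open>g\<close> is an inverse square.\<close>
  obtain x where x: "x \<in> R" and gx: "g = inv (x \<otimes> x)"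
  proof -
    obtain h y where hy: "h \<in> R" "y \<in> carrier G" "g = commutator G h y"
      using g by (auto simp: rel_commutators_def)
    show thesis
    proof (cases "y \<in> R")
      case True
      then show thesis using that[of \<one>] hy R_one commutator_rotations by simp
    next
      case False
      then show thesis using that[of h] hy commutator_rotation_reflection by simp
    qed
  qed
  have "card {\<one>, x, inv x} \<le> 4" by (simp add: card_insert_if)
  then obtain w where w: "w \<in> R" "w \<notin> {\<one>, x, inv x}"
    using R_avoid[of "{\<one>, x, inv x}"] by auto
  have inv_g: "inv g = inv (inv x \<otimes> inv x)"
    using x by (simp add: gx inv_mult_group)
  have "inv (w \<otimes> w) \<noteq> inv (u \<otimes> u)" if "u \<in> R" "w \<noteq> u" for u
    using that w rotation_square_inj[of w u] by (metis R_carrier inv_inv m_closed)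
  then have "inv (w \<otimes> w) \<noteq> g" "inv (w \<otimes> w) \<noteq> inv g"
    using w x R_inv unfolding inv_g by (auto simp: gx)
  then have "(w, y) \<in> parcs (noncomm_graph R G g)" if "y \<in> carrier G" "y \<notin> R" for y
    using that w R_one
    by (auto simp: noncomm_graph_simps[OF R_subgroup] commutator_rotation_reflection)
  with w show ?thesis by blast
qed

lemma connected_diameter_2_rotations:
  assumes g: "g \<in> rel_commutators R G"
  shows "Digraph_Component.connected (with_proj (noncomm_graph R G g)) \<and>
    graph_diameter (with_proj (noncomm_graph R G g)) = 2"
proof -
  let ?\<Gamma> = "noncomm_graph R G g"
  note simps = noncomm_graph_simps[OF R_subgroup]
  have gc: "g \<in> carrier G"
    using g by (auto simp: rel_commutators_def commutator_def)
  note sym = noncomm_graph_sym[OF gc]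
  obtain w where w: "w \<in> R" "w \<noteq> \<one>"
    and w_adj: "\<And>y. y \<in> carrier G \<Longrightarrow> y \<notin> R \<Longrightarrow> (w, y) \<in> parcs ?\<Gamma>"
    using rotation_adjacent_to_reflections[OF g] by blast
  obtain b where b: "b \<in> carrier G" "b \<notin> R" using R_proper by blast
  have rot_rot: "(x, y) \<in> parcs ?\<Gamma>"
    if "x \<in> R" "y \<in> R" "x \<noteq> \<one>" "y \<noteq> \<one>" "x \<noteq> y" "g \<noteq> \<one>" for x y
    using that gc by (auto simp: simps commutator_rotations eq_commute[of \<one>] inv_eq_1_iff)
  have rot_ref: "(x, y) \<in> parcs ?\<Gamma>"
    if "x \<in> R" "x \<noteq> \<one>" "y \<in> carrier G" "y \<notin> R" "g = \<one>" for x y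
  proof -
    have "x \<otimes> x \<noteq> \<one>" using that R_odd by blast
    then show ?thesis
      using that R_one by (auto simp: simps commutator_rotation_reflection inv_eq_1_iff)
  qed
  have mixed: "\<exists>z. (x, z) \<in> parcs ?\<Gamma> \<and> (z, y) \<in> parcs ?\<Gamma>"
    if "x \<in> R" "x \<noteq> \<one>" "y \<in> carrier G" "y \<notin> R" "(x, y) \<notin> parcs ?\<Gamma>" for x y
  proof (intro exI[of _ w] conjI)
    have "g \<noteq> \<one>" using that rot_ref by blast
    moreover have "x \<noteq> w" using that w_adj by blast
    ultimately show "(x, w) \<in> parcs ?\<Gamma>" using that w rot_rot by blast
    show "(w, y) \<in> parcs ?\<Gamma>" using that w_adj by blast
  qed
  have join: "\<exists>z. (x, z) \<in> parcs ?\<Gamma> \<and> (z, y) \<in> parcs ?\<Gamma>"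
    if "x \<in> pverts ?\<Gamma>" "y \<in> pverts ?\<Gamma>" "x \<noteq> y" "(x, y) \<notin> parcs ?\<Gamma>" for x y
  proof -
    have xy: "x \<in> carrier G" "x \<noteq> \<one>" "y \<in> carrier G" "y \<noteq> \<one>"
      using that by (auto simp: simps(1))
    have nadj: "(y, x) \<notin> parcs ?\<Gamma>" using that sym by blast
    consider "x \<in> R" "y \<in> R" | "x \<in> R" "y \<notin> R" | "x \<notin> R" "y \<in> R" | "x \<notin> R" "y \<notin> R"
      by blast
    then show ?thesis
    proof cases
      case 1
      \<comment> \<open>Nonadjacent rotations occur for \<open>g = 1\<close> only; any reflection joins them.\<close>
      then have "g = \<one>" using rot_rot that xy by blast
      then show ?thesis using rot_ref[of x b] rot_ref[of y b] sym 1 b xy by blast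
    next
      case 2
      then show ?thesis using mixed that xy by blast
    next
      case 3
      then show ?thesis using mixed[of y x] nadj xy sym by blast
    next
      case 4
      then show ?thesis using w_adj[of x] w_adj[of y] xy sym by blast
    qed
  qed
  \<comment> \<open>Two distinct reflections are at distance 2, whatever \<open>g\<close> is.\<close>
  have wb: "w \<otimes> b \<in> carrier G" "w \<otimes> b \<notin> R"
    using w b rotation_mult_reflection by blast+
  have "w \<otimes> b \<noteq> b" using w b by simp
  then show ?thesis
    using wb b R_one
    by (intro connected_diameter_2[OF noncomm_graph_wf join, of "w \<otimes> b" b])
      (auto simp: simps)
qed

section \<open>The subgroup generated by a reflection\<close>

lemma generate_reflection:
  assumes s: "s \<in> carrier G" "s \<notin> R"
  shows "generate G {s} = {\<one>, s}"
proof
  have "h \<in> {\<one>, s}" if "h \<in> generate G {s}" for h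
    using that by induction (auto simp: s reflection_inv reflection_square)
  then show "generate G {s} \<subseteq> {\<one>, s}" by blast
  show "{\<one>, s} \<subseteq> generate G {s}" by (auto intro: generate.one generate.incl)
qed

lemma subgroup_reflection:
  assumes "s \<in> carrier G" "s \<notin> R"
  shows "subgroup {\<one>, s} G"
  using generate_is_subgroup[of "{s}"] assms by (simp add: generate_reflection)

lemma connected_diameter_2_reflection:
  assumes s: "s \<in> carrier G" "s \<notin> R"
  shows "Digraph_Component.connected (with_proj (noncomm_graph {\<one>, s} G \<one>)) \<and>
    graph_diameter (with_proj (noncomm_graph {\<one>, s} G \<one>)) = 2"
proof -
  let ?\<Gamma> = "noncomm_graph {\<one>, s} G \<one>"
  note simps = noncomm_graph_simps[OF subgroup_reflection[OF s]]
  have s1: "s \<noteq> \<one>" using s R_one by blast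
  have star: "(s, y) \<in> parcs ?\<Gamma>" if "y \<in> carrier G" "y \<noteq> \<one>" "y \<noteq> s" for y
  proof -
    have "commutator G s y \<noteq> \<one>"
      using that s reflection_centralizer[of s y] by (auto simp: commutator_eq_one_iff)
    then show ?thesis using that s s1 by (simp add: simps)
  qed
  have join: "\<exists>z. (x, z) \<in> parcs ?\<Gamma> \<and> (z, y) \<in> parcs ?\<Gamma>"
    if "x \<in> pverts ?\<Gamma>" "y \<in> pverts ?\<Gamma>" "x \<noteq> y" "(x, y) \<notin> parcs ?\<Gamma>" for x y
  proof -
    have xy: "x \<in> carrier G" "x \<noteq> \<one>" "y \<in> carrier G" "y \<noteq> \<one>"
      using that by (auto simp: simps(1))
    have "(y, x) \<notin> parcs ?\<Gamma>" using that noncomm_graph_sym[OF one_closed] by blast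
    then have "x \<noteq> s" "y \<noteq> s" using star that xy by blast+
    then show ?thesis using star noncomm_graph_sym[OF one_closed] xy by blast
  qed
  obtain x where x: "x \<in> R" "x \<notin> {\<one>}" using R_avoid[of "{\<one>}"] by auto
  obtain y where y: "y \<in> R" "y \<notin> {\<one>, x}"
    using R_avoid[of "{\<one>, x}"] card_insert_le_m1[of 4 "{x}" \<one>] by auto
  show ?thesis
    using x y s
    by (intro connected_diameter_2[OF noncomm_graph_wf join, of x y]) (auto simp: simps)
qed

text \<open>Write \<open>g = [s, y]\<close>. A neighbour of \<open>y\<close> has to be \<open>s\<close>, since \<open>y\<close> itself is not in the subgroup,
  but \<open>s\<close> and \<open>y\<close> are not adjacent by the choice of \<open>g\<close>.\<close>

lemma not_connected_reflection:
  assumes s: "s \<in> carrier G" "s \<notin> R"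
    and g: "g \<in> rel_commutators {\<one>, s} G" "g \<noteq> \<one>"
  shows "\<not> Digraph_Component.connected (with_proj (noncomm_graph {\<one>, s} G g))"
proof -
  note simps = noncomm_graph_simps[OF subgroup_reflection[OF s]]
  obtain h y where hy: "h \<in> {\<one>, s}" "y \<in> carrier G" "g = commutator G h y"
    using g(1) by (auto simp: rel_commutators_def)
  have h: "h = s" using hy g(2) s commutator_eq_one_iff[of \<one> y] by auto
  have y1: "y \<noteq> \<one>" "y \<noteq> s" using hy g(2) s h commutator_eq_one_iff by auto
  have gc: "g \<in> carrier G" using hy s h by (simp add: commutator_def)
  have "(w, y) \<notin> parcs (noncomm_graph {\<one>, s} G g)" for w
    using y1 hy h by (auto simp: simps)
  moreover from this have "(y, w) \<notin> parcs (noncomm_graph {\<one>, s} G g)" for w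
    using noncomm_graph_sym[OF gc] by blast
  ultimately show ?thesis
    using s y1 hy R_one
    by (intro not_connected_if_isolated[OF noncomm_graph_wf, where u = s and v = y]) (auto simp: simps)
qed

end

section \<open>The presentation of the dihedral group\<close>

text \<open>The standard action of the dihedral group on the vertices of the \<open>n\<close>-gon, lifted to the
  integers: the relations hold for it modulo \<open>n\<close>.\<close>

fun letter_act :: "dihedral_gen \<times> bool \<Rightarrow> int \<Rightarrow> int" where
  "letter_act (GenA, True) x = x + 1"
| "letter_act (GenA, False) x = x - 1"
| "letter_act (GenB, _) x = - x"

lemma letter_act_cong:
  assumes "[x = y] (mod m)"
  shows "[letter_act l x = letter_act l y] (mod m)"
  using assms by (cases "(l, x)" rule: letter_act.cases)
    (simp_all add: cong_iff_dvd_diff dvd_diff_commute)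

lemma word_act_cong:
  assumes "[x = y] (mod m)"
  shows "[foldr letter_act w x = foldr letter_act w y] (mod m)"
  by (induction w) (use assms letter_act_cong in simp_all)

lemma rotation_power_act: "(letter_act (GenA, True) ^^ k) x = x + int k"
  by (induction k) auto

lemma word_eq_act:
  assumes "word_eq (dihedral_rels n) u v"
  shows "[foldr letter_act u x = foldr letter_act v x] (mod int n)"
  using assms
proof (induction arbitrary: x)
  case (sym u v)
  show ?case using sym.IH[of x] by (rule cong_sym)
next
  case (trans u v w)
  show ?case using trans.IH[of x] by (rule cong_trans)
next
  case (cancel u l e v)
  have "letter_act (l, e) (letter_act (l, \<not> e) y) = y" for y
    by (cases l; cases e) auto
  then show ?case by simp
next
  case (rel l r u v)
  have "[foldr letter_act l y = foldr letter_act r y] (mod int n)" for y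
  proof -
    consider "l = replicate n (GenA, True)" "r = []"
      | "l = [(GenB, True), (GenB, True)]" "r = []"
      | "l = [(GenB, True), (GenA, True), (GenB, False)]" "r = [(GenA, False)]"
      using rel by (auto simp: dihedral_rels_def numeral_2_eq_2)
    then show ?thesis
      by cases (simp_all add: rotation_power_act cong_def)
  qed
  then show ?case by (simp add: word_act_cong)
qed auto

text \<open>The relations put every element into the form \<open>a\<^sup>k\<close> or \<open>a\<^sup>k b\<close>, and the action shows that \<open>a\<close>
  has order exactly \<open>n\<close> and that \<open>b\<close> is not a power of \<open>a\<close>.\<close>

lemma (in group) odd_dihedral_presentation:
  assumes n: "n \<ge> 5" "odd n" and dih: "is_dihedral G n a b"
  shows "odd_dihedral G (generate G {a})"
    and "a \<in> carrier G" "b \<in> carrier G" "b \<notin> generate G {a}"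
proof -
  let ?f = "case_dihedral_gen a b"
  have "range ?f = {a, b}"
  proof
    show "range ?f \<subseteq> {a, b}" by (auto split: dihedral_gen.split)
    show "{a, b} \<subseteq> range ?f" using rangeI[of ?f GenA] rangeI[of ?f GenB] by simp
  qed
  then have gens: "{a, b} \<subseteq> carrier G" "generate G {a, b} = carrier G"
    and word: "\<And>u v. eval_word G ?f u = eval_word G ?f v \<longleftrightarrow> word_eq (dihedral_rels n) u v"
    using dih by (auto simp: is_dihedral_def presented_by_def)
  show a: "a \<in> carrier G" and b: "b \<in> carrier G" using gens by auto
  have rel: "eval_word G ?f l = eval_word G ?f r" if "(l, r) \<in> dihedral_rels n" for l r
    unfolding word using word_eq.rel[OF that, of "[]" "[]"] by simp
  have eval_pow: "eval_word G ?f (replicate k (GenA, True)) = a [^] k" for k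
    using a by (induction k) (simp_all add: eval_word_def flip: nat_pow_Suc2)
  have an: "a [^] n = \<one>"
    using rel[of "replicate n (GenA, True)" "[]"] eval_pow[of n]
    by (simp add: dihedral_rels_def eval_word_def)
  have bb: "b \<otimes> b = \<one>"
    using rel[of "replicate 2 (GenB, True)" "[]"] b
    by (simp add: dihedral_rels_def eval_word_def numeral_2_eq_2)
  have bbz: "b \<otimes> (b \<otimes> z) = z" if "z \<in> carrier G" for z
    using that b bb by (simp flip: m_assoc)
  have inv_b: "inv b = b" using bb b inv_equality by blast
  have bab: "b \<otimes> a \<otimes> b = inv a"
    using rel[of "[(GenB, True), (GenA, True), (GenB, False)]" "[(GenA, False)]"] a b inv_b
    by (simp add: dihedral_rels_def eval_word_def m_assoc)
  have dvd: "n dvd k" if "a [^] k = \<one>" for k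
  proof -
    have "word_eq (dihedral_rels n) (replicate k (GenA, True)) []"
      using that eval_pow[of k] unfolding word[symmetric] by (simp add: eval_word_def)
    from word_eq_act[OF this, of 0] have "[int k = 0] (mod int n)"
      by (simp add: rotation_power_act)
    then show ?thesis by (simp add: cong_0_iff)
  qed
  have ord: "ord a = n"
    using a an dvd pow_eq_id pow_ord_eq_1 by (metis dvd_antisym)
  define R where "R = generate G {a}"
  have R: "R = {a [^] k | k::nat. True}"
    using generate_pow_nat[OF a] ord n by (auto simp: R_def)
  have sub: "subgroup R G" unfolding R_def using a by (intro generate_is_subgroup) simp
  have Rc: "x \<in> carrier G" if "x \<in> R" for x using that a by (auto simp: R)
  have comm: "x \<otimes> y = y \<otimes> x" if "x \<in> R" "y \<in> R" for x y
    using that a by (auto simp: R nat_pow_mult add.commute)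
  show "b \<notin> generate G {a}"
  proof
    assume "b \<in> generate G {a}"
    then obtain k :: nat where "b = a [^] k" using R R_def by auto
    then have "eval_word G ?f [(GenB, True)] = eval_word G ?f (replicate k (GenA, True))"
      using b eval_pow[of k] by (simp add: eval_word_def)
    then have "word_eq (dihedral_rels n) [(GenB, True)] (replicate k (GenA, True))"
      by (simp add: word)
    \<comment> \<open>A translation that agrees with \<open>x \<mapsto> -x\<close> at 0 and at 1 forces \<open>n\<close> to divide 2.\<close>
    from word_eq_act[OF this, of 0] word_eq_act[OF this, of 1]
    have "int n dvd int k" "int n dvd - 1 - (1 + int k)"
      by (simp_all add: rotation_power_act cong_iff_dvd_diff)
    then have "int n dvd int k + (- 1 - (1 + int k))" by (rule dvd_add)
    then have "int n dvd 2" by simp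
    then show False using n(1) by (auto dest: zdvd_imp_le)
  qed
  then have bR: "b \<notin> R" by (simp add: R_def)
  have bx: "b \<otimes> x \<otimes> b = inv x" if "x \<in> R" for x
  proof -
    obtain k :: nat where k: "x = a [^] k" using \<open>x \<in> R\<close> R by auto
    have "b \<otimes> a [^] k \<otimes> b = inv a [^] k"
    proof (induction k)
      case (Suc k)
      have "b \<otimes> a [^] Suc k \<otimes> b = (b \<otimes> a [^] k \<otimes> b) \<otimes> (b \<otimes> a \<otimes> b)"
        using a b bbz by (simp add: m_assoc)
      then show ?case using Suc bab by simp
    qed (use b bb in simp)
    then show ?thesis using k a nat_pow_inv by simp
  qed
  have bx': "b \<otimes> x = inv x \<otimes> b" if "x \<in> R" for x
    using bx[OF that] b bb Rc[OF that] by (metis m_assoc m_closed r_one)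
  have mult: "(x \<otimes> b) \<otimes> (y \<otimes> b) = x \<otimes> inv y" if "x \<in> R" "y \<in> R" for x y
    using bx[OF that(2)] that b Rc by (simp add: m_assoc)
  have R_m: "x \<otimes> y \<in> R" if "x \<in> R" "y \<in> R" for x y
    using that sub by (simp add: subgroup.m_closed)
  have R_i: "inv x \<in> R" if "x \<in> R" for x
    using that sub by (simp add: subgroup.m_inv_closed)
  note Rclosed = R_m R_i
  have one_R: "\<one> \<in> R" using sub by (rule subgroup.one_closed)
  have bform: "\<exists>x \<in> R. b = x \<otimes> b" using one_R b by (intro bexI[of _ \<one>]) simp_all
  have aR: "a \<in> R" by (simp add: R_def generate.incl)
  have "h \<in> R \<or> (\<exists>x \<in> R. h = x \<otimes> b)" if "h \<in> generate G {a, b}" for h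
    using that
  proof induction
    case one
    then show ?case using one_R by blast
  next
    case (incl h)
    then show ?case using aR bform by blast
  next
    case (inv h)
    then show ?case using aR R_i bform inv_b by fastforce
  next
    case (eng h k)
    have "h \<otimes> k \<in> R \<or> (\<exists>z \<in> R. h \<otimes> k = z \<otimes> b)" if "h = x \<otimes> b" "k \<in> R" "x \<in> R" for x
    proof -
      have "h \<otimes> k = (x \<otimes> inv k) \<otimes> b"
        using that bx'[of k] b Rc by (simp add: m_assoc)
      then show ?thesis using that Rclosed by blast
    qed
    moreover have "h \<otimes> k = (h \<otimes> x) \<otimes> b" if "h \<in> R" "k = x \<otimes> b" "x \<in> R" for x
      using that b Rc by (simp add: m_assoc)
    ultimately show ?case using eng.IH mult Rclosed by metis
  qed
  then have reflection_form: "\<exists>x \<in> R. y = x \<otimes> b" if "y \<in> carrier G" "y \<notin> R" for y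
    using that gens by blast
  show "odd_dihedral G (generate G {a})"
    unfolding R_def[symmetric]
  proof (intro odd_dihedral.intro odd_dihedral_axioms.intro)
    show "group G" by (rule is_group)
    show "subgroup R G" by (rule sub)
    show "x \<otimes> y = y \<otimes> x" if "x \<in> R" "y \<in> R" for x y using comm that .
    show "x = \<one>" if "x \<in> R" "x \<otimes> x = \<one>" for x
    proof -
      obtain k :: nat where k: "x = a [^] k" using \<open>x \<in> R\<close> R by auto
      have "n dvd 2 * k" using that a by (intro dvd) (simp add: k nat_pow_mult mult_2)
      moreover have "coprime n 2" using n(2) by simp
      ultimately have "n dvd k" using coprime_dvd_mult_right_iff by blast
      then show ?thesis using k a ord pow_eq_id by simp
    qed
    show "y \<otimes> y = \<one>" if "y \<in> carrier G" "y \<notin> R" for y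
      using reflection_form[OF that] mult Rc by auto
    show "y \<otimes> z \<in> R" if "y \<in> carrier G" "y \<notin> R" "z \<in> carrier G" "z \<notin> R" for y z
      using reflection_form[OF that(1,2)] reflection_form[OF that(3,4)] mult Rclosed by auto
    show "5 \<le> card R" using generate_pow_card[OF a] ord n by (simp add: R_def)
    show "\<exists>y \<in> carrier G. y \<notin> R" using b bR by blast
  qed
qed

section \<open>The graphs of the dihedral group\<close>

theorem theorem3p7:
  fixes G :: "('g, 'm) monoid_scheme" and a b g :: 'g and H :: "'g set" and n :: nat
  assumes "n \<ge> 5" and "odd n"
    and "is_dihedral G n a b"
    and "subgroup H G"
    and "g \<in> rel_commutators H G"
  shows "(H = generate G {a} \<longrightarrow>
            Digraph_Component.connected (with_proj (noncomm_graph H G g)) \<and>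
            graph_diameter (with_proj (noncomm_graph H G g)) = 2)
       \<and> (\<forall>r::nat. 1 \<le> r \<and> r \<le> n \<and> H = generate G {a [^]\<^bsub>G\<^esub> r \<otimes>\<^bsub>G\<^esub> b} \<longrightarrow>
            (g = \<one>\<^bsub>G\<^esub> \<longrightarrow>
               Digraph_Component.connected (with_proj (noncomm_graph H G g)) \<and>
               graph_diameter (with_proj (noncomm_graph H G g)) = 2) \<and>
            (g \<noteq> \<one>\<^bsub>G\<^esub> \<longrightarrow>
               \<not> Digraph_Component.connected (with_proj (noncomm_graph H G g))))"
proof -
  interpret group G
    using assms(3) by (simp add: is_dihedral_def presented_by_def)
  note pres = odd_dihedral_presentation[OF assms(1-3)]
  interpret odd_dihedral G "generate G {a}" by (rule pres(1))
  have "a [^]\<^bsub>G\<^esub> r \<in> generate G {a}" for r :: nat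
    by (induction r) (auto intro: generate.intros)
  then have s: "a [^]\<^bsub>G\<^esub> r \<otimes>\<^bsub>G\<^esub> b \<in> carrier G" "a [^]\<^bsub>G\<^esub> r \<otimes>\<^bsub>G\<^esub> b \<notin> generate G {a}" for r :: nat
    using rotation_mult_reflection pres(3,4) by blast+
  show ?thesis
    using connected_diameter_2_rotations connected_diameter_2_reflection[OF s]
      not_connected_reflection[OF s] assms(5)
    by (auto simp: generate_reflection[OF s])
qed

end
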